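(* Let $R:\mathcal{P}\to\mathbb{R}$ be concave and $L$-smooth relative to the KL divergence for some $L>0$, i.e. for all $\pi,\pi'\in\mathcal{P}$, $$R[\pi']\le R[\pi]+\langle dR[\pi],\pi'-\pi\rangle,\qquad R[\pi']\ge R[\pi]+\langle dR[\pi],\pi'-\pi\rangle-L\cdot \mathrm{KL}[\pi'\mid\pi].$$ Let $\beta>0$, let $\pi_{\mathrm{ref}}\in\mathcal{P}$, let $\mathcal{L}[\pi]=-R[\pi]+\beta\,\mathrm{KL}[\pi\mid\pi_{\mathrm{ref}}]$, and let $\pi_*\in\mathcal{P}$ be the (unique) minimizer of $\mathcal{L}$ over $\mathcal{P}$. Let $T\ge 1$ and let $\{\pi_t\}_{t=0}^{T}\subset\mathcal{P}$ be the sequence of policies generated by the exact non-linear GRPO algorithm (defined in the context) with step size $\eta=1/L$ from an initial policy $\pi_0\in\mathcal{P}$. Then $$\mathcal{L}[\pi_T]-\mathcal{L}[\pi_*]\le\frac{\beta\cdot \mathrm{KL}[\pi_*\mid\pi_0]}{\left((L+\beta)/L\right)^T-1}.$$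
   Context: $\mathcal{Y}$ is the response space and $\mathcal{P}$ is the set of all policies, i.e. probability distributions $\pi$ on $\mathcal{Y}$, identified with their densities $\pi(y)$ (dependence on a prompt/context variable is suppressed). $\mathrm{KL}[\pi\mid\mu]=\mathbb{E}_{y\sim\pi}\left[\log\frac{\pi(y)}{\mu(y)}\right]$ is the Kullback–Leibler divergence. First-order variation: a map $\frac{\delta R}{\delta\pi}:\mathcal{P}\times\mathcal{Y}\to\mathbb{R}$ is the first-order variation of a functional $R:\mathcal{P}\to\mathbb{R}$ if for all $\pi,\pi'\in\mathcal{P}$, $\frac{d}{d\epsilon}R[\pi+\epsilon(\pi'-\pi)]\big|_{\epsilon=0}=\int\frac{\delta R}{\delta\pi}[\pi](y)\,(\pi'-\pi)(y)\,dy$; the derivative is taken from the right, since $\pi+\epsilon(\pi'-\pi)\in\mathcal{P}$ for $\epsilon\in[0,1]$. It is determined only up to additive constants. It is assumed to exist for all $\pi\in\mathcal{P}$. Write $dR[\pi]=\frac{\delta R}{\delta\pi}[\pi]$ and $\langle dR[\pi],g\rangle=\int dR[\pi](y)\,g(y)\,dy$. Exact non-linear GRPO with step size $\eta>0$: for $t=0,\dots,T-1$, $$\pi_{t+1}=\operatorname*{argmin}_{\pi\in\mathcal{P}}\ \tilde{\mathcal{L}}_t[\pi]+\frac1\eta\mathrm{KL}[\pi\mid\pi_t],\qquad \tilde{\mathcal{L}}_t[\pi]=-\big(R[\pi_t]+\langle dR[\pi_t],\pi-\pi_t\rangle\big)+\beta\,\mathrm{KL}[\pi\mid\pi_{\mathrm{ref}}],$$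 where the minimization is solved exactly at each step. *)

theory Defs
  imports "HOL-Probability.Information"
begin

text \<open>
  The response space is a measure space \<open>M\<close> (assumed sigma-finite in the theorem) whose measure
  plays the role of \<open>dy\<close>: Lebesgue measure, a counting measure, etc.  A policy is represented by
  its density with respect to \<open>M\<close>.
\<close>

text \<open>The Bochner integral of a non-integrable function is 0, so \<open>\<integral>y. \<pi> y \<partial>M = 1\<close> includes integrability.\<close>

definition policies :: "'a measure \<Rightarrow> ('a \<Rightarrow> real) set" where
  "policies M = {\<pi>. \<pi> \<in> borel_measurable M \<and> (\<forall>y\<in>space M. 0 \<le> \<pi> y) \<and> (\<integral>y. \<pi> y \<partial>M) = 1}"

text \<open>
  The library constant \<^const>\<open>KL_divergence\<close> is real-valued and returns junk when the divergence
  is infinite.  The negative part of the log-density ratio is always integrable with respect to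
  \<open>\<pi>\<close>, so if the integral does not converge then the divergence is \<open>+\<infinity>\<close>.
\<close>

definition KL :: "'a measure \<Rightarrow> ('a \<Rightarrow> real) \<Rightarrow> ('a \<Rightarrow> real) \<Rightarrow> ereal" where
  "KL M \<pi> \<mu> =
    (if absolutely_continuous (density M \<mu>) (density M \<pi>) \<and>
        integrable (density M \<pi>) (entropy_density (exp 1) (density M \<mu>) (density M \<pi>))
     then ereal (KL_divergence (exp 1) (density M \<mu>) (density M \<pi>))
     else \<infinity>)"

definition pairing :: "'a measure \<Rightarrow> ('a \<Rightarrow> real) \<Rightarrow> ('a \<Rightarrow> real) \<Rightarrow> real" where
  "pairing M f g = (\<integral>y. f y * g y \<partial>M)"

text \<open>
  The derivative is taken within \<open>{0..1}\<close>, i.e. from the right.  That the integral on the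
  right-hand side exists is part of the definition.
\<close>

definition is_first_variation ::
    "'a measure \<Rightarrow> (('a \<Rightarrow> real) \<Rightarrow> real) \<Rightarrow> (('a \<Rightarrow> real) \<Rightarrow> 'a \<Rightarrow> real) \<Rightarrow> bool" where
  "is_first_variation M R dR \<longleftrightarrow>
    (\<forall>\<pi>\<in>policies M. \<forall>\<pi>'\<in>policies M.
       integrable M (\<lambda>y. dR \<pi> y * (\<pi>' y - \<pi> y)) \<and>
       ((\<lambda>\<epsilon>. R (\<lambda>y. \<pi> y + \<epsilon> * (\<pi>' y - \<pi> y))) has_real_derivative
          pairing M (dR \<pi>) (\<lambda>y. \<pi>' y - \<pi> y)) (at 0 within {0..1}))"

definition concave_functional ::
    "'a measure \<Rightarrow> (('a \<Rightarrow> real) \<Rightarrow> real) \<Rightarrow> (('a \<Rightarrow> real) \<Rightarrow> 'a \<Rightarrow> real) \<Rightarrow> bool" where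
  "concave_functional M R dR \<longleftrightarrow>
    (\<forall>\<pi>\<in>policies M. \<forall>\<pi>'\<in>policies M.
       R \<pi>' \<le> R \<pi> + pairing M (dR \<pi>) (\<lambda>y. \<pi>' y - \<pi> y))"

definition KL_smooth ::
    "'a measure \<Rightarrow> real \<Rightarrow> (('a \<Rightarrow> real) \<Rightarrow> real) \<Rightarrow> (('a \<Rightarrow> real) \<Rightarrow> 'a \<Rightarrow> real) \<Rightarrow> bool" where
  "KL_smooth M L R dR \<longleftrightarrow>
    (\<forall>\<pi>\<in>policies M. \<forall>\<pi>'\<in>policies M.
       ereal (R \<pi>') \<ge>
         ereal (R \<pi> + pairing M (dR \<pi>) (\<lambda>y. \<pi>' y - \<pi> y)) - ereal L * KL M \<pi>' \<pi>)"

definition loss ::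
    "'a measure \<Rightarrow> (('a \<Rightarrow> real) \<Rightarrow> real) \<Rightarrow> real \<Rightarrow> ('a \<Rightarrow> real) \<Rightarrow> ('a \<Rightarrow> real) \<Rightarrow> ereal" where
  "loss M R \<beta> \<pi>ref \<pi> = ereal (- R \<pi>) + ereal \<beta> * KL M \<pi> \<pi>ref"

definition linearized_loss ::
    "'a measure \<Rightarrow> (('a \<Rightarrow> real) \<Rightarrow> real) \<Rightarrow> (('a \<Rightarrow> real) \<Rightarrow> 'a \<Rightarrow> real) \<Rightarrow> real \<Rightarrow>
      ('a \<Rightarrow> real) \<Rightarrow> ('a \<Rightarrow> real) \<Rightarrow> ('a \<Rightarrow> real) \<Rightarrow> ereal" where
  "linearized_loss M R dR \<beta> \<pi>ref \<pi>t \<pi> =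
     ereal (- (R \<pi>t + pairing M (dR \<pi>t) (\<lambda>y. \<pi> y - \<pi>t y))) + ereal \<beta> * KL M \<pi> \<pi>ref"

text \<open>
  The subproblem minimizer is unique only up to \<open>M\<close>-null sets (its argument being a density
  function), so each step says that \<open>p (Suc t)\<close> is a minimizer.
\<close>

definition exact_GRPO ::
    "'a measure \<Rightarrow> (('a \<Rightarrow> real) \<Rightarrow> real) \<Rightarrow> (('a \<Rightarrow> real) \<Rightarrow> 'a \<Rightarrow> real) \<Rightarrow> real \<Rightarrow>
      ('a \<Rightarrow> real) \<Rightarrow> real \<Rightarrow> nat \<Rightarrow> (nat \<Rightarrow> 'a \<Rightarrow> real) \<Rightarrow> bool" where
  "exact_GRPO M R dR \<beta> \<pi>ref \<eta> T p \<longleftrightarrow>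
    p 0 \<in> policies M \<and>
    (\<forall>t<T. is_arg_min
       (\<lambda>\<pi>. linearized_loss M R dR \<beta> \<pi>ref (p t) \<pi> + ereal (1 / \<eta>) * KL M \<pi> (p t))
       (\<lambda>\<pi>. \<pi> \<in> policies M) (p (Suc t)))"

lemma policies_prob_space:
  assumes "\<pi> \<in> policies M"
  shows "prob_space (density M \<pi>)"
proof -
  have "integrable M \<pi>"
    using assms not_integrable_integral_eq by (fastforce simp: policies_def)
  then have "(\<integral>\<^sup>+y. ennreal (\<pi> y) \<partial>M) = 1"
    using assms by (subst nn_integral_eq_integral) (auto simp: policies_def)
  then show ?thesis
    using assms
    by (intro prob_spaceI) (auto simp: policies_def emeasure_density cong: nn_integral_cong)
qed

text \<open>On policies, \<^const>\<open>KL\<close> is the expectation of the log-density ratio.\<close>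

lemma KL_policies:
  assumes "sigma_finite_measure M" and \<pi>: "\<pi> \<in> policies M" and \<mu>: "\<mu> \<in> policies M"
  shows "KL M \<pi> \<mu> =
    (if (AE y in M. \<mu> y = 0 \<longrightarrow> \<pi> y = 0) \<and> integrable (density M \<pi>) (\<lambda>y. ln (\<pi> y / \<mu> y))
     then ereal (\<integral>y. ln (\<pi> y / \<mu> y) \<partial>density M \<pi>) else \<infinity>)"
proof -
  interpret sigma_finite_measure M by fact
  have m[measurable]: "\<pi> \<in> borel_measurable M" "\<mu> \<in> borel_measurable M"
    and nn: "AE y in M. 0 \<le> \<pi> y" "AE y in M. 0 \<le> \<mu> y"
    using \<pi> \<mu> by (auto simp: policies_def)
  interpret Q: prob_space "density M \<mu>" by (rule policies_prob_space[OF \<mu>])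
  have ac: "absolutely_continuous (density M \<mu>) (density M \<pi>) \<longleftrightarrow> (AE y in M. \<mu> y = 0 \<longrightarrow> \<pi> y = 0)"
    (is "?A \<longleftrightarrow> ?B")
  proof
    assume ?A
    have "AE y in density M \<mu>. \<mu> y \<noteq> 0" by (simp add: AE_density)
    with \<open>?A\<close> have "AE y in density M \<pi>. \<mu> y \<noteq> 0"
      by (intro absolutely_continuous_AE[of "density M \<pi>" "density M \<mu>"]) auto
    with nn(1) show ?B by (auto simp: AE_density elim!: eventually_elim2)
  next
    assume ?B
    then have "density M \<pi> = density (density M \<mu>) (\<lambda>y. \<pi> y / \<mu> y)"
      using nn by (subst density_density_divide) auto
    moreover have "absolutely_continuous (density M \<mu>) (density (density M \<mu>) (\<lambda>y. \<pi> y / \<mu> y))"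
      by (rule absolutely_continuousI_density) measurable
    ultimately show ?A by simp
  qed
  have ed: "AE y in density M \<pi>. entropy_density (exp 1) (density M \<mu>) (density M \<pi>) y = ln (\<pi> y / \<mu> y)"
    if B: ?B
  proof -
    have "density (density M \<mu>) (\<lambda>y. \<pi> y / \<mu> y) = density M \<pi>"
      using nn B by (subst density_density_divide) auto
    then have "AE y in density M \<mu>. ennreal (\<pi> y / \<mu> y) = RN_deriv (density M \<mu>) (density M \<pi>) y"
      by (intro Q.RN_deriv_unique) auto
    then have "AE y in density M \<pi>. ennreal (\<pi> y / \<mu> y) = RN_deriv (density M \<mu>) (density M \<pi>) y"
      using ac B by (intro absolutely_continuous_AE[of "density M \<pi>" "density M \<mu>"]) auto
    moreover have "AE y in density M \<pi>. 0 \<le> \<pi> y / \<mu> y"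
      using nn by (simp add: AE_density) (auto elim!: eventually_elim2)
    ultimately show ?thesis
      by eventually_elim (simp add: entropy_density_def log_def, metis enn2real_ennreal)
  qed
  have [measurable]: "entropy_density (exp 1) (density M \<mu>) (density M \<pi>) \<in> borel_measurable M"
    unfolding entropy_density_def by measurable
  show ?thesis
  proof (cases ?B)
    case True
    then show ?thesis
      unfolding KL_def ac KL_divergence_def
      using integrable_cong_AE[OF _ _ ed[OF True]] integral_cong_AE[OF _ _ ed[OF True]] by simp
  qed (simp add: KL_def ac)
qed

end

theory Submission
  imports Defs "HOL-Real_Asymp.Real_Asymp"
begin

text \<open>
  Each step is a mirror-descent step for the Bregman divergence KL: by relative smoothness and
  concavity, the three-point inequality at the subproblem minimizer, compared with \<open>\<pi>star\<close>, gives
  \<open>\<delta> (t+1) + (L + \<beta>) D (t+1) \<le> L D t\<close>, where \<open>\<delta> t\<close> is the loss gap and \<open>D t = KL(\<pi>star | p t)\<close>.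
  Weighting these inequalities by powers of \<open>(L + \<beta>) / L\<close>, they telescope, and \<open>\<delta>\<close> is nonincreasing.
\<close>

section \<open>Pointwise properties of the KL integrand\<close>

text \<open>
  The terms \<open>- a + b\<close> integrate to 0 over two policies and make the integrand nonnegative, so that
  KL becomes a nonnegative integral, to which Fatou's lemma applies and for which infinite values
  need no separate integrability argument.
\<close>

definition kl_integrand :: "real \<Rightarrow> real \<Rightarrow> ennreal" where
  "kl_integrand a b =
    (if b = 0 then (if a = 0 then 0 else top) else ennreal (a * ln (a / b) - a + b))"

lemma kl_integrand_measurable [measurable]:
  assumes [measurable]: "f \<in> borel_measurable M" "g \<in> borel_measurable M"
  shows "(\<lambda>y. kl_integrand (f y) (g y)) \<in> borel_measurable M"
  unfolding kl_integrand_def by measurable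

lemma kl_integrand_self: "kl_integrand a a = 0"
  by (simp add: kl_integrand_def)

text \<open>Apply \<open>ln x \<le> x - 1\<close> at \<open>x = b / a\<close> and multiply by
  \<open>a\<close>. This nonnegativity keeps \<open>ennreal\<close> from truncating the
  integrand.\<close>

lemma mult_ln_divide_ge:
  fixes a b :: real
  assumes "0 \<le> a" "0 < b"
  shows "0 \<le> a * ln (a / b) - a + b"
proof (cases "a = 0")
  case False
  with assms have a: "0 < a" by simp
  have "ln (b / a) \<le> b / a - 1"
    using a assms by (intro ln_le_minus_one) simp
  then have "a * ln (b / a) \<le> a * (b / a - 1)"
    using a by (intro mult_left_mono) auto
  then show ?thesis
    using a assms by (simp add: ln_div algebra_simps)
qed (use assms in simp)

text \<open>Pointwise compensation identity: \<open>ln (x / m) = ln (x / c) + ln (c / m)\<close>,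
  and averaging \<open>x * ln (c / m)\<close> over \<open>x = a\<close> and \<open>x = b\<close>
  gives \<open>c * ln (c / m)\<close>. As an equation of sums in \<open>ennreal\<close> it survives
  infinite terms: if \<open>m = 0 < c\<close>, both sides are \<open>top\<close>.\<close>

lemma kl_integrand_mixture:
  assumes "0 \<le> a" "0 \<le> b" "0 \<le> m" "0 < e" "e < 1"
  defines "c \<equiv> a + e * (b - a)"
  shows "ennreal (1 - e) * kl_integrand a m + ennreal e * kl_integrand b m =
    kl_integrand c m + (ennreal (1 - e) * kl_integrand a c + ennreal e * kl_integrand b c)"
proof -
  have c_eq: "c = (1 - e) * a + e * b" by (simp add: c_def algebra_simps)
  have c0: "c = 0 \<longleftrightarrow> a = 0 \<and> b = 0"
    using assms(1-5) unfolding c_eq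
    by (subst add_nonneg_eq_0_iff) auto
  have c_nonneg: "0 \<le> c" using assms(1-5) by (simp add: c_eq)
  show ?thesis
  proof (cases "c = 0")
    case True
    then have "a = 0" "b = 0" using c0 by auto
    then show ?thesis
      using True assms(3-5)
      by (simp add: kl_integrand_def flip: ennreal_plus ennreal_mult distrib_right)
  next
    case False
    then have c: "0 < c" using c_nonneg by simp
    show ?thesis
    proof (cases "m = 0")
      case True
      have "a \<noteq> 0 \<or> b \<noteq> 0" using False c0 by auto
      then show ?thesis
        using True False assms(4,5)
        by (auto simp: kl_integrand_def ennreal_mult_eq_top_iff ennreal_mult_top)
    next
      case m: False
      then have m: "0 < m" using assms(3) by simp
      have ln_split: "x * ln (x / m) = x * ln (x / c) + x * ln (c / m)" if "0 \<le> x" for x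
        using that c m by (cases "x = 0") (auto simp: ln_div algebra_simps)
      have "(1 - e) * (a * ln (a / m) - a + m) + e * (b * ln (b / m) - b + m) =
        (c * ln (c / m) - c + m) +
        ((1 - e) * (a * ln (a / c) - a + c) + e * (b * ln (b / c) - b + c))"
        unfolding ln_split[OF assms(1)] ln_split[OF assms(2)]
        by (simp add: c_eq algebra_simps)
      moreover note mult_ln_divide_ge[OF assms(1) m] mult_ln_divide_ge[OF assms(2) m]
        mult_ln_divide_ge[OF assms(1) c] mult_ln_divide_ge[OF assms(2) c]
        mult_ln_divide_ge[OF c_nonneg m]
      ultimately show ?thesis
        using m c assms(4,5)
        by (simp add: kl_integrand_def flip: ennreal_plus ennreal_mult)
    qed
  qed
qed

text \<open>The pointwise limit behind the Fatou argument. Moving the second argument towards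
  \<open>a\<close> makes it positive when \<open>c = 0 < a\<close>; the integrand then grows like
  \<open>a * ln n\<close>, which matches the value \<open>top\<close> at
  \<open>c = 0\<close>.\<close>

lemma kl_integrand_tendsto:
  assumes "0 \<le> a" "0 \<le> c"
  shows "(\<lambda>n. kl_integrand a (c + 1 / real (n + 2) * (a - c))) \<longlonglongrightarrow> kl_integrand a c"
proof -
  let ?c = "\<lambda>n. c + 1 / real (n + 2) * (a - c)"
  have lim: "?c \<longlonglongrightarrow> c" by real_asymp
  show ?thesis
  proof (cases "c = 0")
    case c: False
    then have "0 < c" using assms by simp
    have "eventually (\<lambda>n. 0 < ?c n) sequentially"
      by (rule order_tendstoD(1)[OF lim \<open>0 < c\<close>])
    then have "eventually (\<lambda>n. kl_integrand a (?c n) =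
        ennreal (a * ln (a / ?c n) - a + ?c n)) sequentially"
      by eventually_elim (simp add: kl_integrand_def)
    moreover have "(\<lambda>n. ennreal (a * ln (a / ?c n) - a + ?c n)) \<longlonglongrightarrow>
        ennreal (a * ln (a / c) - a + c)"
    proof (cases "a = 0")
      case True
      then show ?thesis using lim by (intro tendsto_ennrealI) simp
    next
      case False
      then show ?thesis using c lim by (intro tendsto_ennrealI tendsto_intros lim) auto
    qed
    ultimately show ?thesis
      using c by (simp add: kl_integrand_def tendsto_cong)
  next
    case c: True
    show ?thesis
    proof (cases "a = 0")
      case False
      then have a: "0 < a" using assms by simp
      have "filterlim (\<lambda>n. a * ln (a / ?c n) - a + ?c n) at_top sequentially"
        using a unfolding c by real_asymp
      then have "(\<lambda>n. ennreal (a * ln (a / ?c n) - a + ?c n)) \<longlonglongrightarrow> top"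
        by (subst ennreal_tendsto_top_eq_at_top)
      then show ?thesis
        using a c by (simp add: kl_integrand_def)
    qed (simp add: c kl_integrand_def)
  qed
qed

section \<open>Policies, and KL as a nonnegative integral\<close>

lemma policiesD:
  assumes "\<pi> \<in> policies M"
  shows "\<pi> \<in> borel_measurable M" "\<And>y. y \<in> space M \<Longrightarrow> 0 \<le> \<pi> y"
    "integrable M \<pi>" "(\<integral>y. \<pi> y \<partial>M) = 1"
  using assms not_integrable_integral_eq by (fastforce simp: policies_def)+

lemma policies_mixture:
  assumes "\<pi> \<in> policies M" "\<pi>' \<in> policies M" "0 \<le> e" "e \<le> 1"
  shows "(\<lambda>y. \<pi> y + e * (\<pi>' y - \<pi> y)) \<in> policies M"
proof -
  note [measurable] = policiesD(1)[OF assms(1)] policiesD(1)[OF assms(2)]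
  note [simp] = policiesD(3)[OF assms(1)] policiesD(3)[OF assms(2)]
    policiesD(4)[OF assms(1)] policiesD(4)[OF assms(2)]
  have "0 \<le> \<pi> y + e * (\<pi>' y - \<pi> y)" if "y \<in> space M" for y
  proof -
    have "\<pi> y + e * (\<pi>' y - \<pi> y) = (1 - e) * \<pi> y + e * \<pi>' y"
      by (simp add: algebra_simps)
    then show ?thesis
      using policiesD(2)[OF assms(1) that] policiesD(2)[OF assms(2) that] assms(3,4) by simp
  qed
  then show ?thesis by (simp add: policies_def)
qed

definition kl_integral :: "'a measure \<Rightarrow> ('a \<Rightarrow> real) \<Rightarrow> ('a \<Rightarrow> real) \<Rightarrow> ennreal" where
  "kl_integral M \<pi> \<mu> = (\<integral>\<^sup>+y. kl_integrand (\<pi> y) (\<mu> y) \<partial>M)"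

text \<open>The added terms cancel because both densities have integral 1. Both ways for
  \<open>KL\<close> to be infinite give \<open>top\<close>: without absolute continuity the
  integrand is \<open>top\<close> on a set that is not null, and a nonnegative measurable function
  that is not integrable has infinite integral.\<close>

lemma KL_eq_kl_integral:
  assumes "sigma_finite_measure M" and \<pi>: "\<pi> \<in> policies M" and \<mu>: "\<mu> \<in> policies M"
  shows "KL M \<pi> \<mu> = enn2ereal (kl_integral M \<pi> \<mu>)"
proof -
  note [measurable] = policiesD(1)[OF \<pi>] policiesD(1)[OF \<mu>]
  note [simp] = policiesD(3,4)[OF \<pi>] policiesD(3,4)[OF \<mu>]
  have nn: "AE y in M. 0 \<le> \<pi> y" "AE y in M. 0 \<le> \<mu> y"
    using policiesD(2)[OF \<pi>] policiesD(2)[OF \<mu>] by auto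
  let ?h = "\<lambda>y. \<pi> y * ln (\<pi> y / \<mu> y)"
  let ?g = "\<lambda>y. ?h y - \<pi> y + \<mu> y"
  show ?thesis
  proof (cases "AE y in M. \<mu> y = 0 \<longrightarrow> \<pi> y = 0")
    case True
    have g: "AE y in M. 0 \<le> ?g y \<and> kl_integrand (\<pi> y) (\<mu> y) = ennreal (?g y)"
      using nn True
    proof eventually_elim
      case (elim y)
      then show ?case
        using mult_ln_divide_ge[of "\<pi> y" "\<mu> y"]
        by (cases "\<mu> y = 0") (auto simp: kl_integrand_def)
    qed
    then have g_nn: "AE y in M. 0 \<le> ?g y" by auto
    have eq: "kl_integral M \<pi> \<mu> = (\<integral>\<^sup>+y. ennreal (?g y) \<partial>M)"
      unfolding kl_integral_def by (rule nn_integral_cong_AE) (use g in auto)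
    have h_g: "integrable M ?h \<longleftrightarrow> integrable M ?g"
    proof
      assume g: "integrable M ?g"
      have h: "?h = (\<lambda>y. ?g y + (\<pi> y - \<mu> y))" by (simp add: fun_eq_iff)
      have d: "integrable M (\<lambda>y. \<pi> y - \<mu> y)" by simp
      show "integrable M ?h"
        by (subst h) (rule Bochner_Integration.integrable_add[OF g d])
    qed auto
    have dens: "integrable (density M \<pi>) (\<lambda>y. ln (\<pi> y / \<mu> y)) \<longleftrightarrow> integrable M ?h"
      using nn by (subst integrable_density) auto
    show ?thesis
    proof (cases "integrable M ?h")
      case int: True
      have "(\<integral>y. ln (\<pi> y / \<mu> y) \<partial>density M \<pi>) = (\<integral>y. ?h y \<partial>M)"
        using nn by (subst integral_density) auto
      also have "\<dots> = (\<integral>y. ?g y \<partial>M)"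
        using int by simp
      finally have "KL M \<pi> \<mu> = ereal (\<integral>y. ?g y \<partial>M)"
        using KL_policies[OF assms] True int dens by simp
      moreover have "(\<integral>\<^sup>+y. ennreal (?g y) \<partial>M) = ennreal (\<integral>y. ?g y \<partial>M)"
        using int h_g g_nn by (intro nn_integral_eq_integral) auto
      moreover have "0 \<le> (\<integral>y. ?g y \<partial>M)"
        using g_nn by (rule integral_nonneg_AE)
      ultimately show ?thesis
        unfolding eq by (simp add: enn2ereal_ennreal)
    next
      case False
      then have "\<not> (\<integral>\<^sup>+y. ennreal (?g y) \<partial>M) < \<infinity>"
        using h_g integrableI_nonneg[OF _ g_nn] by force
      then have "(\<integral>\<^sup>+y. ennreal (?g y) \<partial>M) = top"
        by (simp add: not_less top_unique)
      then show ?thesis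
        using KL_policies[OF assms] False dens unfolding eq by simp
    qed
  next
    case False
    have "kl_integral M \<pi> \<mu> = top"
    proof (rule ccontr)
      assume "kl_integral M \<pi> \<mu> \<noteq> top"
      then have "AE y in M. kl_integrand (\<pi> y) (\<mu> y) \<noteq> \<infinity>"
        unfolding kl_integral_def by (intro nn_integral_noteq_infinite) auto
      then have "AE y in M. \<mu> y = 0 \<longrightarrow> \<pi> y = 0"
        by eventually_elim (auto simp: kl_integrand_def split: if_splits)
      then show False using False by simp
    qed
    then show ?thesis
      using KL_policies[OF assms] False by simp
  qed
qed

lemma kl_integral_self: "kl_integral M \<pi> \<pi> = 0"
  by (simp add: kl_integral_def kl_integrand_self)

text \<open>The last bracket does not depend on \<open>\<mu>\<close>: KL terms with different second
  arguments have the same convexity gap along the segment, so weighted sums of them can be handled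
  together.\<close>

lemma kl_integral_mixture:
  assumes \<pi>: "\<pi> \<in> policies M" and \<pi>': "\<pi>' \<in> policies M" and \<mu>: "\<mu> \<in> policies M"
    and e: "0 < e" "e < 1"
  defines "\<nu> \<equiv> \<lambda>y. \<pi> y + e * (\<pi>' y - \<pi> y)"
  shows "ennreal (1 - e) * kl_integral M \<pi> \<mu> + ennreal e * kl_integral M \<pi>' \<mu> =
    kl_integral M \<nu> \<mu> +
    (ennreal (1 - e) * kl_integral M \<pi> \<nu> + ennreal e * kl_integral M \<pi>' \<nu>)"
proof -
  note [measurable] = policiesD(1)[OF \<pi>] policiesD(1)[OF \<pi>'] policiesD(1)[OF \<mu>]
  have [measurable]: "\<nu> \<in> borel_measurable M" unfolding \<nu>_def by measurable
  have "(\<integral>\<^sup>+y. ennreal (1 - e) * kl_integrand (\<pi> y) (\<mu> y) +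
          ennreal e * kl_integrand (\<pi>' y) (\<mu> y) \<partial>M) =
    (\<integral>\<^sup>+y. kl_integrand (\<nu> y) (\<mu> y) + (ennreal (1 - e) * kl_integrand (\<pi> y) (\<nu> y) +
          ennreal e * kl_integrand (\<pi>' y) (\<nu> y)) \<partial>M)"
    unfolding \<nu>_def
    by (intro nn_integral_cong kl_integrand_mixture policiesD(2)[OF \<pi>] policiesD(2)[OF \<pi>']
        policiesD(2)[OF \<mu>] e)
  then show ?thesis
    unfolding kl_integral_def by (simp add: nn_integral_add nn_integral_cmult)
qed

text \<open>Fatou's lemma along a sequence of mixtures that tends to \<open>\<mu>\<close>.\<close>

lemma kl_integral_lower_semicontinuous:
  assumes \<pi>: "\<pi> \<in> policies M" and \<mu>: "\<mu> \<in> policies M"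
    and le: "\<And>e. 0 < e \<Longrightarrow> e < 1 \<Longrightarrow> kl_integral M \<pi> (\<lambda>y. \<mu> y + e * (\<pi> y - \<mu> y)) \<le> C"
  shows "kl_integral M \<pi> \<mu> \<le> C"
proof -
  note [measurable] = policiesD(1)[OF \<pi>] policiesD(1)[OF \<mu>]
  \<comment> \<open>The shift by 2 keeps \<open>e = 1 / (n + 2)\<close> strictly between 0 and 1 for
    every \<open>n\<close>.\<close>
  let ?f = "\<lambda>n y. kl_integrand (\<pi> y) (\<mu> y + 1 / real (n + 2) * (\<pi> y - \<mu> y))"
  have "kl_integral M \<pi> \<mu> = (\<integral>\<^sup>+y. liminf (\<lambda>n. ?f n y) \<partial>M)"
    unfolding kl_integral_def
  proof (rule nn_integral_cong)
    fix y assume "y \<in> space M"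
    then have "(\<lambda>n. ?f n y) \<longlonglongrightarrow> kl_integrand (\<pi> y) (\<mu> y)"
      by (intro kl_integrand_tendsto policiesD(2)[OF \<pi>] policiesD(2)[OF \<mu>])
    then show "kl_integrand (\<pi> y) (\<mu> y) = liminf (\<lambda>n. ?f n y)"
      by (simp add: lim_imp_Liminf)
  qed
  also have "\<dots> \<le> liminf (\<lambda>n. \<integral>\<^sup>+y. ?f n y \<partial>M)"
    by (rule nn_integral_liminf) measurable
  also have "\<dots> \<le> liminf (\<lambda>n::nat. C)"
    using le[of "1 / real (_ + 2)"] unfolding kl_integral_def
    by (intro Liminf_mono always_eventually allI) auto
  also have "\<dots> = C" by (simp add: Liminf_const)
  finally show ?thesis .
qed

section \<open>The three-point inequality\<close>

text \<open>
  Comparing \<open>q\<close> with \<open>q + e (\<pi> - q)\<close> and using the mixture identity gives the bound with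
  \<open>KL(\<pi> | q + e (\<pi> - q))\<close> in place of \<open>KL(\<pi> | q)\<close>, without any derivative; then \<open>e\<close> tends to 0.
\<close>

lemma three_point_inequality:
  assumes M: "sigma_finite_measure M"
    and q: "q \<in> policies M" and \<pi>: "\<pi> \<in> policies M"
    and r: "r \<in> policies M" and s: "s \<in> policies M"
    and ab: "0 < a" "0 < b"
    and affine: "\<And>e. 0 < e \<Longrightarrow> e < 1 \<Longrightarrow>
      l (\<lambda>y. q y + e * (\<pi> y - q y)) = (1 - e) * l q + e * l \<pi>"
    and min: "\<And>\<rho>. \<rho> \<in> policies M \<Longrightarrow>
      ereal (l q) + ereal b * KL M q r + ereal a * KL M q s
        \<le> ereal (l \<rho>) + ereal b * KL M \<rho> r + ereal a * KL M \<rho> s"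
    and fin: "KL M \<pi> r \<noteq> \<infinity>" "KL M \<pi> s \<noteq> \<infinity>"
  obtains qr qs \<pi>r \<pi>s \<pi>q where
    "KL M q r = ereal qr" "KL M q s = ereal qs" "KL M \<pi> r = ereal \<pi>r" "KL M \<pi> s = ereal \<pi>s"
    "KL M \<pi> q = ereal \<pi>q" "l q + b * qr + a * qs + (a + b) * \<pi>q \<le> l \<pi> + b * \<pi>r + a * \<pi>s"
proof -
  note KL = KL_eq_kl_integral[OF M]
  have real: "\<exists>x\<ge>0. kl_integral M f g = ennreal x \<and> KL M f g = ereal x"
    if "f \<in> policies M" "g \<in> policies M" "kl_integral M f g \<noteq> top" for f g
    using that by (cases "kl_integral M f g") (auto simp: KL enn2ereal_ennreal)
  obtain \<pi>r \<pi>s where \<pi>rs: "0 \<le> \<pi>r" "kl_integral M \<pi> r = ennreal \<pi>r" "KL M \<pi> r = ereal \<pi>r"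
      "0 \<le> \<pi>s" "kl_integral M \<pi> s = ennreal \<pi>s" "KL M \<pi> s = ereal \<pi>s"
    using real[OF \<pi> r] real[OF \<pi> s] fin by (auto simp: KL[OF \<pi> r] KL[OF \<pi> s])
  \<comment> \<open>The objective is finite at \<open>\<pi>\<close>, hence at the minimizer
    \<open>q\<close>, and both weights are positive.\<close>
  have "KL M q r \<noteq> \<infinity>" "KL M q s \<noteq> \<infinity>"
    using min[OF \<pi>] ab \<pi>rs enn2ereal_nonneg[of "kl_integral M q r"]
      enn2ereal_nonneg[of "kl_integral M q s"]
    unfolding KL[OF q r, symmetric] KL[OF q s, symmetric]
    by (cases "KL M q r"; cases "KL M q s"; simp)+
  then obtain qr qs where qrs: "0 \<le> qr" "kl_integral M q r = ennreal qr" "KL M q r = ereal qr"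
      "0 \<le> qs" "kl_integral M q s = ennreal qs" "KL M q s = ereal qs"
    using real[OF q r] real[OF q s] by (auto simp: KL[OF q r] KL[OF q s])
  \<comment> \<open>\<open>C\<close> is the final inequality solved for
    \<open>KL M \<pi> q\<close>.\<close>
  define C where "C = (l \<pi> + b * \<pi>r + a * \<pi>s - (l q + b * qr + a * qs)) / (a + b)"
  have bound: "kl_integral M \<pi> (\<lambda>y. q y + e * (\<pi> y - q y)) \<le> ennreal C"
    if e: "0 < e" "e < 1" for e
  proof -
    let ?n = "\<lambda>y. q y + e * (\<pi> y - q y)"
    have n: "?n \<in> policies M" using e by (intro policies_mixture q \<pi>) auto
    have mix_r: "ennreal (1 - e) * ennreal qr + ennreal e * ennreal \<pi>r = kl_integral M ?n r +
        (ennreal (1 - e) * kl_integral M q ?n + ennreal e * kl_integral M \<pi> ?n)"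
      using kl_integral_mixture[OF q \<pi> r e] qrs \<pi>rs by simp
    have mix_s: "ennreal (1 - e) * ennreal qs + ennreal e * ennreal \<pi>s = kl_integral M ?n s +
        (ennreal (1 - e) * kl_integral M q ?n + ennreal e * kl_integral M \<pi> ?n)"
      using kl_integral_mixture[OF q \<pi> s e] qrs \<pi>rs by simp
    \<comment> \<open>The left sides of the mixture identities are finite, hence so is each summand
      on the right; \<open>0 < e < 1\<close> makes the weights nonzero. The identities can then be
      read in the reals.\<close>
    have "kl_integral M ?n r + (ennreal (1 - e) * kl_integral M q ?n + ennreal e * kl_integral M \<pi> ?n) \<noteq> top"
      "kl_integral M ?n s + (ennreal (1 - e) * kl_integral M q ?n + ennreal e * kl_integral M \<pi> ?n) \<noteq> top"
      unfolding mix_r[symmetric] mix_s[symmetric]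
      by (auto simp: ennreal_mult_eq_top_iff)
    then have "kl_integral M ?n r \<noteq> top" "kl_integral M ?n s \<noteq> top"
      "kl_integral M q ?n \<noteq> top" "kl_integral M \<pi> ?n \<noteq> top"
      using e by (auto simp: ennreal_mult_eq_top_iff)
    then obtain nr ns qn \<pi>n where n_eq:
      "0 \<le> nr" "kl_integral M ?n r = ennreal nr" "KL M ?n r = ereal nr"
      "0 \<le> ns" "kl_integral M ?n s = ennreal ns" "KL M ?n s = ereal ns"
      "0 \<le> qn" "kl_integral M q ?n = ennreal qn"
      "0 \<le> \<pi>n" "kl_integral M \<pi> ?n = ennreal \<pi>n"
      using real[OF n r] real[OF n s] real[OF q n] real[OF \<pi> n] by metis
    have R: "(1 - e) * qr + e * \<pi>r = nr + ((1 - e) * qn + e * \<pi>n)"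
      using mix_r e n_eq qrs \<pi>rs by (simp flip: ennreal_plus ennreal_mult)
    have S: "(1 - e) * qs + e * \<pi>s = ns + ((1 - e) * qn + e * \<pi>n)"
      using mix_s e n_eq qrs \<pi>rs by (simp flip: ennreal_plus ennreal_mult)
    have "l q + b * qr + a * qs \<le> l ?n + b * nr + a * ns"
      using min[OF n] unfolding n_eq qrs by simp
    also have "\<dots> = (1 - e) * (l q + b * qr + a * qs) + e * (l \<pi> + b * \<pi>r + a * \<pi>s) -
        (a + b) * ((1 - e) * qn + e * \<pi>n)"
    proof -
      have nr: "nr = (1 - e) * qr + e * \<pi>r - ((1 - e) * qn + e * \<pi>n)"
        and ns: "ns = (1 - e) * qs + e * \<pi>s - ((1 - e) * qn + e * \<pi>n)"
        using R S by simp_all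
      show ?thesis unfolding affine[OF e] nr ns by (simp add: algebra_simps)
    qed
    finally have "(a + b) * ((1 - e) * qn) + e * ((a + b) * \<pi>n) \<le>
        e * (l \<pi> + b * \<pi>r + a * \<pi>s - (l q + b * qr + a * qs))"
      by (simp add: algebra_simps)
    moreover have "0 \<le> (a + b) * ((1 - e) * qn)" using ab e n_eq by simp
    ultimately have "e * ((a + b) * \<pi>n) \<le> e * (l \<pi> + b * \<pi>r + a * \<pi>s - (l q + b * qr + a * qs))"
      by linarith
    then have "(a + b) * \<pi>n \<le> l \<pi> + b * \<pi>r + a * \<pi>s - (l q + b * qr + a * qs)"
      using e by simp
    then have "\<pi>n \<le> C"
      using ab unfolding C_def by (simp add: pos_le_divide_eq mult.commute)
    then show ?thesis unfolding n_eq by (rule ennreal_leI)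
  qed
  have le: "kl_integral M \<pi> q \<le> ennreal C"
    by (rule kl_integral_lower_semicontinuous[OF \<pi> q bound])
  then have "kl_integral M \<pi> q \<noteq> top" by (auto simp: top_unique)
  then obtain \<pi>q where \<pi>q: "0 \<le> \<pi>q" "kl_integral M \<pi> q = ennreal \<pi>q" "KL M \<pi> q = ereal \<pi>q"
    using real[OF \<pi> q] by auto
  \<comment> \<open>\<open>ennreal\<close> sends negative reals to 0, so the bound by
    \<open>ennreal C\<close> yields a real inequality only once \<open>C\<close> is known to be
    nonnegative.\<close>
  have "0 \<le> C"
    using min[OF \<pi>] ab unfolding qrs \<pi>rs C_def by simp
  then have "\<pi>q \<le> C" using le \<pi>q by simp
  then have "l q + b * qr + a * qs + (a + b) * \<pi>q \<le> l \<pi> + b * \<pi>r + a * \<pi>s"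
    using ab unfolding C_def by (simp add: pos_le_divide_eq algebra_simps)
  then show thesis using that qrs \<pi>rs \<pi>q by blast
qed

section \<open>Telescoping the recursion\<close>

text \<open>\<open>mono\<close> starts at \<open>t = 1\<close> because the loss at the initial
  policy may be infinite, so that no gap is available at time 0.\<close>

lemma geometric_weighted_decrease:
  fixes \<delta> D :: "nat \<Rightarrow> real"
  assumes pos: "0 < L" "0 < \<beta>" and T: "1 \<le> T"
    and step: "\<And>t. t < T \<Longrightarrow> \<delta> (Suc t) + (L + \<beta>) * D (Suc t) \<le> L * D t"
    and mono: "\<And>t. 1 \<le> t \<Longrightarrow> t < T \<Longrightarrow> \<delta> (Suc t) \<le> \<delta> t"
    and D: "0 \<le> D T"
  shows "\<delta> T \<le> \<beta> * D 0 / (((L + \<beta>) / L) ^ T - 1)"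
proof -
  define r where "r = (L + \<beta>) / L"
  have r: "1 < r" using pos by (simp add: r_def field_simps)
  have Lr: "L + \<beta> = L * r" and \<beta>r: "\<beta> = L * (r - 1)" using pos by (simp_all add: r_def field_simps)
  have \<delta>_ge: "\<delta> T \<le> \<delta> t" if "1 \<le> t" "t \<le> T" for t
    using that(2,1)
  proof (induction rule: inc_induct)
    case (step n)
    then show ?case using mono[of n] by simp
  qed simp
  \<comment> \<open>Step \<open>n\<close> gets weight \<open>(r - 1) * r ^ n\<close>. Since
    \<open>\<beta> = L * (r - 1)\<close>, its \<open>D\<close> terms become
    \<open>\<beta> * r ^ Suc n * D (Suc n)\<close> and \<open>\<beta> * r ^ n * D n\<close>, which
    telescope; the first \<open>n\<close> weights add up to \<open>r ^ n - 1\<close>.\<close>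
  have sum: "\<delta> T * (r ^ n - 1) + \<beta> * r ^ n * D n \<le> \<beta> * D 0" if "n \<le> T" for n
    using that
  proof (induction n)
    case (Suc n)
    have "\<delta> T + (L * r) * D (Suc n) \<le> L * D n"
      using step[of n] \<delta>_ge[of "Suc n"] Suc.prems unfolding Lr by simp
    then have "((r - 1) * r ^ n) * (\<delta> T + (L * r) * D (Suc n)) \<le> ((r - 1) * r ^ n) * (L * D n)"
      using r by (intro mult_left_mono) auto
    with Suc show ?case unfolding \<beta>r by (simp add: algebra_simps)
  qed simp
  have "0 \<le> \<beta> * r ^ T * D T" using pos r D by simp
  then have "\<delta> T * (r ^ T - 1) \<le> \<beta> * D 0" using sum[of T] by simp
  moreover have "0 < r ^ T - 1" using r T by (simp add: one_less_power)
  ultimately show ?thesis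
    unfolding r_def[symmetric] by (simp add: pos_le_divide_eq)
qed

section \<open>Convergence rate of exact GRPO\<close>

theorem theorem5p2:
  fixes M :: "'a measure"
    and R :: "('a \<Rightarrow> real) \<Rightarrow> real"
    and dR :: "('a \<Rightarrow> real) \<Rightarrow> 'a \<Rightarrow> real"
    and L \<beta> :: real
    and \<pi>ref \<pi>star :: "'a \<Rightarrow> real"
    and T :: nat
    and p :: "nat \<Rightarrow> 'a \<Rightarrow> real"
  assumes "sigma_finite_measure M"
    and "is_first_variation M R dR"
    and "0 < L"
    and "concave_functional M R dR"
    and "KL_smooth M L R dR"
    and "0 < \<beta>"
    and "\<pi>ref \<in> policies M"
    and "is_arg_min (loss M R \<beta> \<pi>ref) (\<lambda>\<pi>. \<pi> \<in> policies M) \<pi>star"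
    and "1 \<le> T"
    and "exact_GRPO M R dR \<beta> \<pi>ref (1 / L) T p"
  shows "loss M R \<beta> \<pi>ref (p T) - loss M R \<beta> \<pi>ref \<pi>star
    \<le> ereal \<beta> * KL M \<pi>star (p 0) / ereal (((L + \<beta>) / L) ^ T - 1)"
proof -
  note M = assms(1) and L = assms(3) and \<beta> = assms(6) and ref = assms(7) and T = assms(9)
  have star: "\<pi>star \<in> policies M"
    and star_min: "\<And>\<pi>. \<pi> \<in> policies M \<Longrightarrow> loss M R \<beta> \<pi>ref \<pi>star \<le> loss M R \<beta> \<pi>ref \<pi>"
    using assms(8) by (auto simp: is_arg_min_def not_less)
  have p: "p t \<in> policies M" if "t \<le> T" for t
    using that assms(10) by (cases t) (auto simp: exact_GRPO_def is_arg_min_def Suc_le_eq)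
  have KL_self: "KL M \<pi> \<pi> = 0" if "\<pi> \<in> policies M" for \<pi>
    using that by (simp add: KL_eq_kl_integral[OF M] kl_integral_self zero_ennreal.rep_eq)
  have KL_nonneg: "0 \<le> KL M \<pi> \<mu>" if "\<pi> \<in> policies M" "\<mu> \<in> policies M" for \<pi> \<mu>
    using that by (simp add: KL_eq_kl_integral[OF M])
  define r where "r = ((L + \<beta>) / L) ^ T - 1"
  have r: "0 < r" using L \<beta> T by (simp add: r_def one_less_power)
  \<comment> \<open>The reference policy has KL 0 to itself, so its loss is finite and bounds the
    minimal loss.\<close>
  have "loss M R \<beta> \<pi>ref \<pi>star \<noteq> \<infinity>"
    using star_min[OF ref] by (auto simp: loss_def KL_self[OF ref])
  then have star_ref: "KL M \<pi>star \<pi>ref \<noteq> \<infinity>"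
    using \<beta> by (auto simp: loss_def)
  \<comment> \<open>\<open>- l t\<close> is the tangent of \<open>R\<close> at \<open>p t\<close>:
    concavity puts \<open>R\<close> below it, and smoothness bounds the gap by
    \<open>L * KL M \<pi> (p t)\<close>.\<close>
  define l where "l t \<pi> = - (R (p t) + pairing M (dR (p t)) (\<lambda>y. \<pi> y - p t y))" for t \<pi>
  have min: "ereal (l t (p (Suc t))) + ereal \<beta> * KL M (p (Suc t)) \<pi>ref +
      ereal L * KL M (p (Suc t)) (p t)
      \<le> ereal (l t \<rho>) + ereal \<beta> * KL M \<rho> \<pi>ref + ereal L * KL M \<rho> (p t)"
    if "t < T" "\<rho> \<in> policies M" for t \<rho>
    using that assms(10)
    by (auto simp: exact_GRPO_def is_arg_min_def linearized_loss_def l_def not_less)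
  have affine: "l t (\<lambda>y. q y + e * (\<pi> y - q y)) = (1 - e) * l t q + e * l t \<pi>"
    if "t \<le> T" "q \<in> policies M" "\<pi> \<in> policies M" for t q \<pi> e
  proof -
    \<comment> \<open>The integrals exist by \<open>is_first_variation\<close>; this is what makes
      the pairing additive.\<close>
    have "integrable M (\<lambda>y. dR (p t) y * (q y - p t y))"
      "integrable M (\<lambda>y. dR (p t) y * (\<pi> y - p t y))"
      using that p assms(2) by (auto simp: is_first_variation_def)
    then have "(\<integral>y. (1 - e) * (dR (p t) y * (q y - p t y)) + e * (dR (p t) y * (\<pi> y - p t y)) \<partial>M) =
      (1 - e) * (\<integral>y. dR (p t) y * (q y - p t y) \<partial>M) + e * (\<integral>y. dR (p t) y * (\<pi> y - p t y) \<partial>M)"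
      by simp
    moreover have "(\<lambda>y. dR (p t) y * (q y + e * (\<pi> y - q y) - p t y)) =
      (\<lambda>y. (1 - e) * (dR (p t) y * (q y - p t y)) + e * (dR (p t) y * (\<pi> y - p t y)))"
      by (simp add: algebra_simps)
    ultimately show ?thesis
      unfolding l_def pairing_def by (simp add: algebra_simps)
  qed
  have concave: "- l t \<pi> \<ge> R \<pi>" if "t \<le> T" "\<pi> \<in> policies M" for t \<pi>
    using assms(4) p[OF that(1)] that(2)
    unfolding concave_functional_def l_def minus_minus by blast
  have smooth: "ereal (R \<pi>) \<ge> ereal (- l t \<pi>) - ereal L * KL M \<pi> (p t)"
    if "t \<le> T" "\<pi> \<in> policies M" for t \<pi>
    using assms(5) p[OF that(1)] that(2)
    unfolding KL_smooth_def l_def minus_minus by blast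
  show ?thesis
  \<comment> \<open>If this divergence is infinite, so is the right-hand side; otherwise everything
    reduces to reals.\<close>
  proof (cases "KL M \<pi>star (p 0) = \<infinity>")
    case True
    then show ?thesis using \<beta> r unfolding r_def[symmetric] by simp
  next
    case False
    define D where "D t = real_of_ereal (KL M \<pi>star (p t))" for t
    define K where "K t = real_of_ereal (KL M (p t) \<pi>ref)" for t
    define k where "k = real_of_ereal (KL M \<pi>star \<pi>ref)"
    have k: "KL M \<pi>star \<pi>ref = ereal k"
      using star_ref KL_nonneg[OF star ref] by (auto simp: k_def ereal_real)
    \<comment> \<open>\<open>real_of_ereal\<close> sends infinity to 0, so \<open>D\<close> and
      \<open>K\<close> are meaningful only once finiteness is known; each step therefore carries
      finiteness along with the inequality.\<close>
    have steps: "KL M \<pi>star (p (Suc t)) = ereal (D (Suc t)) \<and> KL M (p (Suc t)) \<pi>ref = ereal (K (Suc t)) \<and>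
        - R (p (Suc t)) + \<beta> * K (Suc t) + (L + \<beta>) * D (Suc t) \<le> - R \<pi>star + \<beta> * k + L * D t"
      if tT: "t < T" and Dt: "KL M \<pi>star (p t) = ereal (D t)" for t
    proof -
      have t: "t \<le> T" "Suc t \<le> T" using tT by auto
      have Dt_fin: "KL M \<pi>star (p t) \<noteq> \<infinity>" using Dt by simp
      obtain qr qs \<pi>r \<pi>s \<pi>q where *: "KL M (p (Suc t)) \<pi>ref = ereal qr"
        "KL M (p (Suc t)) (p t) = ereal qs" "KL M \<pi>star \<pi>ref = ereal \<pi>r"
        "KL M \<pi>star (p t) = ereal \<pi>s" "KL M \<pi>star (p (Suc t)) = ereal \<pi>q"
        "l t (p (Suc t)) + \<beta> * qr + L * qs + (L + \<beta>) * \<pi>q \<le> l t \<pi>star + \<beta> * \<pi>r + L * \<pi>s"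
        by (rule three_point_inequality[OF M p[OF t(2)] star ref p[OF t(1)] L \<beta>
              affine[OF t(1) p[OF t(2)] star] min[OF tT] star_ref Dt_fin])
      \<comment> \<open>The step size \<open>1 / L\<close> enters here: the proximal term
        \<open>L * qs\<close> is exactly the error that relative smoothness allows.\<close>
      have "- R (p (Suc t)) \<le> l t (p (Suc t)) + L * qs"
        using smooth[OF t(1) p[OF t(2)]] *(2) by simp
      moreover have "l t \<pi>star \<le> - R \<pi>star"
        using concave[OF t(1) star] by simp
      moreover have "D (Suc t) = \<pi>q" "K (Suc t) = qr"
        using * by (simp_all add: D_def K_def)
      moreover have "\<pi>s = D t" "\<pi>r = k"
        using * k Dt by simp_all
      ultimately show ?thesis
        using * by simp
    qed
    have D: "KL M \<pi>star (p t) = ereal (D t)" if "t \<le> T" for t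
      using that
    proof (induction t)
      case 0
      then show ?case
        using False KL_nonneg[OF star p[of 0]] by (auto simp: D_def ereal_real)
    qed (use steps in auto)
    \<comment> \<open>Starts at 1: \<open>p 0\<close> may have infinite KL to the reference policy,
      while each later policy minimizes an objective that is finite at
      \<open>\<pi>star\<close>.\<close>
    have K: "KL M (p t) \<pi>ref = ereal (K t)" if "1 \<le> t" "t \<le> T" for t
      using that steps[of "t - 1"] D[of "t - 1"] by simp
    define \<delta> where "\<delta> t = (- R (p t) + \<beta> * K t) - (- R \<pi>star + \<beta> * k)" for t
    have "\<delta> T \<le> \<beta> * D 0 / r"
      unfolding r_def
    proof (rule geometric_weighted_decrease[OF L \<beta> T])
      show "\<delta> (Suc t) + (L + \<beta>) * D (Suc t) \<le> L * D t" if "t < T" for t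
        using steps[OF that] D[of t] that by (simp add: \<delta>_def)
      show "0 \<le> D T"
        using D[of T] KL_nonneg[OF star p[of T]] by simp
      show "\<delta> (Suc t) \<le> \<delta> t" if t: "1 \<le> t" "t < T" for t
      proof -
        have pt: "p t \<in> policies M" "p (Suc t) \<in> policies M" using t p by auto
        \<comment> \<open>The minimizer is compared with \<open>p t\<close> itself, whose linear
          part is \<open>- R (p t)\<close> and whose proximal term is 0. Smoothness then absorbs the
          proximal term of \<open>p (Suc t)\<close>.\<close>
        have le: "ereal (l t (p (Suc t))) + ereal \<beta> * ereal (K (Suc t)) + ereal L * KL M (p (Suc t)) (p t)
            \<le> ereal (- R (p t)) + ereal \<beta> * ereal (K t)"
          using min[OF t(2) pt(1)] K[of t] K[of "Suc t"] t
          by (simp add: KL_self[OF pt(1)] l_def pairing_def)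
        have "- R (p (Suc t)) + \<beta> * K (Suc t) \<le> - R (p t) + \<beta> * K t"
          using le smooth[OF less_imp_le[OF t(2)] pt(2)] L KL_nonneg[OF pt(2,1)]
          by (cases "KL M (p (Suc t)) (p t)") auto
        then show ?thesis by (simp add: \<delta>_def)
      qed
    qed
    moreover have "loss M R \<beta> \<pi>ref (p T) - loss M R \<beta> \<pi>ref \<pi>star = ereal (\<delta> T)"
      using K[of T] T k by (simp add: loss_def \<delta>_def)
    ultimately show ?thesis
      using D[of 0] r unfolding r_def[symmetric] by simp
  qed
qed

end
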